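(* Let $\ell$ be a surrogate loss with $0\le\ell\le B_\ell$, and suppose that the following $\mathcal{H}$-consistency bound holds, with $\Gamma\colon\mathbb{R}_+\to\mathbb{R}_+$ a non-decreasing concave function: $$\forall h\in\mathcal{H},\quad \mathcal{E}_{\ell_{0-1}}(h)-\mathcal{E}^*_{\ell_{0-1}}(\mathcal{H})+\mathcal{M}_{\ell_{0-1}}(\mathcal{H})\le\Gamma\left(\mathcal{E}_\ell(h)-\mathcal{E}^*_\ell(\mathcal{H})+\mathcal{M}_\ell(\mathcal{H})\right).$$ Let $S=((x_1,y_1),\ldots,(x_m,y_m))$ be an i.i.d. sample drawn from $\mathcal{D}^m$, and let $\widehat h_S\in\operatorname{argmin}_{h\in\mathcal{H}}\frac1m\sum_{i=1}^m\ell(h,x_i,y_i)$ be an empirical minimizer of $\ell$ within $\mathcal{H}$. Then, for any $\delta>0$, with probability at least $1-\delta$ over the draw of $S$, $$\mathcal{E}_{\ell_{0-1}}(\widehat h_S)-\mathcal{E}^*_{\ell_{0-1}}(\mathcal{H})\le\Gamma\left(4\,\mathfrak{R}_m^{\ell}(\mathcal{H})+2B_\ell\sqrt{\frac{\log\frac2\delta}{2m}}+\mathcal{M}_\ell(\mathcal{H})\right)-\mathcal{M}_{\ell_{0-1}}(\mathcal{H}).$$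
   Context: Input space $\mathcal{X}$, label space $\mathcal{Y}=\{1,\ldots,n\}$, $\mathcal{D}$ a distribution over $\mathcal{X}\times\mathcal{Y}$, $\mathcal{H}$ a family of measurable functions $h\colon\mathcal{X}\times\mathcal{Y}\to\mathbb{R}$. $\ell_{0-1}(h,x,y)=1_{\mathsf{h}(x)\ne y}$ with $\mathsf{h}(x)=\operatorname{argmax}_{y}h(x,y)$ (ties broken by the highest index). For a loss $\ell$, with $p(x,y)=\mathcal{D}(Y=y\mid X=x)$: $\mathcal{E}_\ell(h)=\mathbb{E}_{(x,y)\sim\mathcal{D}}[\ell(h,x,y)]$, $\mathcal{E}^*_\ell(\mathcal{H})=\inf_{h\in\mathcal{H}}\mathcal{E}_\ell(h)$, $\mathcal{C}^*_\ell(\mathcal{H},x)=\inf_{h\in\mathcal{H}}\sum_yp(x,y)\ell(h,x,y)$, and the minimizability gap is $\mathcal{M}_\ell(\mathcal{H})=\mathcal{E}^*_\ell(\mathcal{H})-\mathbb{E}_x[\mathcal{C}^*_\ell(\mathcal{H},x)]$. $\mathfrak{R}_m^\ell(\mathcal{H})$ is the Rademacher complexity of $\{(x,y)\mapsto\ell(h,x,y)\colon h\in\mathcal{H}\}$: $\mathfrak{R}_m^\ell(\mathcal{H})=\mathbb{E}_{S,\sigma}\left[\sup_{h\in\mathcal{H}}\frac1m\sum_{i=1}^m\sigma_i\ell(h,x_i,y_i)\right]$ with $S\sim\mathcal{D}^m$ and $\sigma_i$ independent uniform on $\{-1,+1\}$. Usual measurability of the suprema involved is assumed. *)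

theory Defs
  imports "HOL-Probability.Probability"
begin

text \<open>Labels are the naturals in \<open>{1..n}\<close>; only the values of a hypothesis \<open>h x y\<close> with
  \<open>x \<in> space X\<close> and \<open>y \<in> {1..n}\<close> are meaningful.\<close>

type_synonym 'x hyp = "'x \<Rightarrow> nat \<Rightarrow> real"
type_synonym 'x loss = "'x hyp \<Rightarrow> 'x \<Rightarrow> nat \<Rightarrow> real"
type_synonym 'x sample = "nat \<Rightarrow> 'x \<times> nat"

abbreviation labelled :: "'x measure \<Rightarrow> nat \<Rightarrow> ('x \<times> nat) measure" where
  "labelled X n \<equiv> X \<Otimes>\<^sub>M count_space {1..n}"

abbreviation marginal :: "'x measure \<Rightarrow> ('x \<times> nat) measure \<Rightarrow> 'x measure" where
  "marginal X D \<equiv> distr D X fst"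

abbreviation iid_sample :: "('x \<times> nat) measure \<Rightarrow> nat \<Rightarrow> 'x sample measure" where
  "iid_sample D m \<equiv> Pi\<^sub>M {..<m} (\<lambda>_. D)"

text \<open>\<open>p\<close> is a version of the regular conditional distribution of the label given the input.
  Any two versions agree for almost every \<open>x\<close>.\<close>

definition cond_label_prob ::
    "'x measure \<Rightarrow> nat \<Rightarrow> ('x \<times> nat) measure \<Rightarrow> ('x \<Rightarrow> nat \<Rightarrow> real) \<Rightarrow> bool" where
  "cond_label_prob X n D p \<longleftrightarrow>
     (\<forall>y\<in>{1..n}. (\<lambda>x. p x y) \<in> borel_measurable X) \<and>
     (\<forall>x\<in>space X. (\<forall>y\<in>{1..n}. 0 \<le> p x y) \<and> (\<Sum>y=1..n. p x y) = 1) \<and>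
     (\<forall>A\<in>sets X. \<forall>y\<in>{1..n}. measure D (A \<times> {y}) = (LINT x:A|marginal X D. p x y))"

definition predict :: "nat \<Rightarrow> 'x hyp \<Rightarrow> 'x \<Rightarrow> nat" where
  "predict n h x = Max {y \<in> {1..n}. \<forall>y'\<in>{1..n}. h x y' \<le> h x y}"

definition zero_one_loss :: "nat \<Rightarrow> 'x loss" where
  "zero_one_loss n h x y = (if predict n h x \<noteq> y then 1 else 0)"

definition risk :: "('x \<times> nat) measure \<Rightarrow> 'x loss \<Rightarrow> 'x hyp \<Rightarrow> real" where
  "risk D l h = (LINT (x, y)|D. l h x y)"

definition best_risk :: "('x \<times> nat) measure \<Rightarrow> 'x loss \<Rightarrow> 'x hyp set \<Rightarrow> real" where
  "best_risk D l H = (INF h\<in>H. risk D l h)"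

definition best_cond_risk ::
    "nat \<Rightarrow> ('x \<Rightarrow> nat \<Rightarrow> real) \<Rightarrow> 'x loss \<Rightarrow> 'x hyp set \<Rightarrow> 'x \<Rightarrow> real" where
  "best_cond_risk n p l H x = (INF h\<in>H. \<Sum>y=1..n. p x y * l h x y)"

definition minimizability_gap ::
    "'x measure \<Rightarrow> nat \<Rightarrow> ('x \<times> nat) measure \<Rightarrow> ('x \<Rightarrow> nat \<Rightarrow> real) \<Rightarrow> 'x loss \<Rightarrow> 'x hyp set \<Rightarrow> real"
  where
  "minimizability_gap X n D p l H =
     best_risk D l H - (LINT x|marginal X D. best_cond_risk n p l H x)"

definition empirical_risk :: "nat \<Rightarrow> 'x loss \<Rightarrow> 'x sample \<Rightarrow> 'x hyp \<Rightarrow> real" where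
  "empirical_risk m l S h = (1 / real m) * (\<Sum>i<m. l h (fst (S i)) (snd (S i)))"

definition rademacher_sup ::
    "nat \<Rightarrow> 'x loss \<Rightarrow> 'x hyp set \<Rightarrow> (nat \<Rightarrow> real) \<Rightarrow> 'x sample \<Rightarrow> real" where
  "rademacher_sup m l H \<sigma> S =
     (SUP h\<in>H. (1 / real m) * (\<Sum>i<m. \<sigma> i * l h (fst (S i)) (snd (S i))))"

definition rademacher_complexity ::
    "('x \<times> nat) measure \<Rightarrow> nat \<Rightarrow> 'x loss \<Rightarrow> 'x hyp set \<Rightarrow> real" where
  "rademacher_complexity D m l H =
     (LINT S|iid_sample D m.
        measure_pmf.expectation (Pi_pmf {..<m} 0 (\<lambda>_. pmf_of_set {-1, 1}))
          (\<lambda>\<sigma>. rademacher_sup m l H \<sigma> S))"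

text \<open>An empirical minimizer is an arbitrary selection, so an event about it need not be
  measurable; "with probability at least \<open>q\<close>" is read as: the event contains a measurable event
  of probability at least \<open>q\<close>. For measurable events this is the usual meaning, as the lemma
  below shows.\<close>

definition holds_with_prob :: "'a measure \<Rightarrow> real \<Rightarrow> ('a \<Rightarrow> bool) \<Rightarrow> bool" where
  "holds_with_prob M q P \<longleftrightarrow> (\<exists>A\<in>sets M. q \<le> measure M A \<and> (\<forall>x\<in>A. P x))"

lemma (in prob_space) holds_with_prob_iff:
  assumes "{x \<in> space M. P x} \<in> sets M"
  shows "holds_with_prob M q P \<longleftrightarrow> q \<le> prob {x \<in> space M. P x}"
proof
  assume "holds_with_prob M q P"
  then obtain A where A: "A \<in> sets M" "q \<le> prob A" "\<forall>x\<in>A. P x"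
    unfolding holds_with_prob_def by blast
  have "A \<subseteq> {x \<in> space M. P x}"
    using A sets.sets_into_space by blast
  then have "prob A \<le> prob {x \<in> space M. P x}"
    using assms by (rule finite_measure_mono)
  then show "q \<le> prob {x \<in> space M. P x}"
    using A by linarith
next
  assume "q \<le> prob {x \<in> space M. P x}"
  then show "holds_with_prob M q P"
    unfolding holds_with_prob_def using assms by blast
qed

end

theory Submission
  imports Defs
begin

text \<open>Excess risk of the empirical minimizer is controlled by the sum of the two one-sided uniform
  deviations of the empirical risk. These suprema need not be measurable, and neither need be the
  supremum over pairs of a sample and a ghost sample. But exchanging the two samples in the
  coordinates where a sign vector \<open>\<sigma>\<close> is \<open>-1\<close> bounds the latter by Rademacher suprema of the
  exchanged samples, which are measurable; this holds for every \<open>\<sigma>\<close>. Averaging over \<open>\<sigma>\<close> and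
  integrating out the ghost sample gives a measurable majorant of the excess risk that has mean
  \<open>4 R\<close> and whose value changes by at most \<open>2 B / m\<close> if one point changes, so one application of
  McDiarmid's inequality suffices.\<close>

section \<open>McDiarmid's inequality\<close>

text \<open>Oscillation at most \<open>c\<close> places the range of \<open>f\<close> in the
  interval from its infimum \<open>a\<close> to \<open>a + c\<close>, and Hoeffding's lemma sees
  only the length of that interval. No endpoints have to be supplied, which suits sections of a
  function of several variables. The nonnegative integral lets the bound be nested under Tonelli's
  theorem.\<close>

lemma (in prob_space) Hoeffdings_lemma_oscillation:
  fixes f :: "'a \<Rightarrow> real"
  assumes f: "f \<in> borel_measurable M"
    and osc: "\<And>x y. x \<in> space M \<Longrightarrow> y \<in> space M \<Longrightarrow> f x - f y \<le> c"
    and s: "0 < s"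
  shows "(\<integral>\<^sup>+x. exp (s * f x) \<partial>M) \<le> ennreal (exp (s * expectation f + s\<^sup>2 * c\<^sup>2 / 8))"
proof -
  obtain x0 where x0: "x0 \<in> space M"
    using not_empty by blast
  define a where "a = (INF x\<in>space M. f x)"
  have bdd: "bdd_below (f ` space M)"
    by (rule bdd_belowI2[of _ "f x0 - c"]) (use osc[OF x0] in \<open>simp add: algebra_simps\<close>)
  have lower: "a \<le> f x" if "x \<in> space M" for x
    unfolding a_def using bdd that by (rule cINF_lower)
  have upper: "f x \<le> a + c" if "x \<in> space M" for x
  proof -
    have "f x - c \<le> a"
      unfolding a_def using not_empty osc[OF that]
      by (intro cINF_greatest) (auto simp: algebra_simps)
    then show ?thesis
      by simp
  qed
  interpret interval_bounded_random_variable M f a "a + c"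
    by unfold_locales (use f lower upper in auto)
  have "(\<integral>\<^sup>+x. exp (s * f x) \<partial>M)
      = (\<integral>\<^sup>+x. ennreal (exp (s * expectation f)) * ennreal (exp (s * (f x - expectation f))) \<partial>M)"
    by (intro nn_integral_cong)
      (simp flip: ennreal_mult' exp_add add: algebra_simps)
  also have "\<dots> = ennreal (exp (s * expectation f))
      * (\<integral>\<^sup>+x. ennreal (exp (s * (f x - expectation f))) \<partial>M)"
    by (rule nn_integral_cmult) simp
  also have "\<dots> \<le> ennreal (exp (s * expectation f)) * ennreal (exp (s\<^sup>2 * (a + c - a)\<^sup>2 / 8))"
    by (intro mult_left_mono Hoeffdings_lemma_nn_integral s) simp
  also have "\<dots> = ennreal (exp (s * expectation f + s\<^sup>2 * c\<^sup>2 / 8))"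
    by (simp flip: ennreal_mult' add: exp_add)
  finally show ?thesis .
qed

text \<open>Induction on the coordinates takes the place of a martingale. Averaging \<open>f\<close>
  over coordinate \<open>i\<close> gives \<open>g\<close>, which inherits the bound \<open>K\<close>
  and the differences \<open>c j\<close> of the other coordinates. For fixed other coordinates
  \<open>f\<close> oscillates by at most \<open>c i\<close> around its mean \<open>g x\<close>, so
  Hoeffding's lemma costs a factor exp(s^2 (c i)^2 / 8) and leaves the exponential moment of
  \<open>g\<close>.\<close>

lemma (in product_prob_space) mgf_bounded_differences:
  fixes f :: "('i \<Rightarrow> 'a) \<Rightarrow> real" and c :: "'i \<Rightarrow> real"
  assumes "finite I" "f \<in> borel_measurable (Pi\<^sub>M I M)"
    and "\<And>x. x \<in> space (Pi\<^sub>M I M) \<Longrightarrow> \<bar>f x\<bar> \<le> K"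
    and "\<And>x i z. x \<in> space (Pi\<^sub>M I M) \<Longrightarrow> i \<in> I \<Longrightarrow> z \<in> space (M i) \<Longrightarrow> \<bar>f (x(i := z)) - f x\<bar> \<le> c i"
    and s: "0 < s"
  shows "(\<integral>\<^sup>+x. exp (s * f x) \<partial>Pi\<^sub>M I M)
    \<le> ennreal (exp (s * (\<integral>x. f x \<partial>Pi\<^sub>M I M) + s\<^sup>2 * (\<Sum>i\<in>I. (c i)\<^sup>2) / 8))"
  using assms(1-4)
proof (induction I arbitrary: f rule: finite_induct)
  case empty
  then show ?case
    by (simp add: PiM_empty nn_integral_count_space_finite lebesgue_integral_count_space_finite)
next
  case (insert i J)
  note [measurable] = insert.prems(1)
  interpret J: prob_space "Pi\<^sub>M J M"
    by (rule prob_space_PiM) (rule prob_space)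
  interpret iJ: prob_space "Pi\<^sub>M (insert i J) M"
    by (rule prob_space_PiM) (rule prob_space)
  define g where "g x = (\<integral>y. f (x(i := y)) \<partial>M i)" for x
  have g_measurable [measurable]: "g \<in> borel_measurable (Pi\<^sub>M J M)"
    unfolding g_def by measurable
  have upd: "x(i := y) \<in> space (Pi\<^sub>M (insert i J) M)"
    if "x \<in> space (Pi\<^sub>M J M)" "y \<in> space (M i)" for x y
    using that by (auto simp: space_PiM PiE_iff extensional_def)
  have section_measurable: "(\<lambda>y. f (x(i := y))) \<in> borel_measurable (M i)"
    if "x \<in> space (Pi\<^sub>M J M)" for x
    using measurable_component_update[OF that \<open>i \<notin> J\<close>] by measurable
  have section_integrable: "integrable (M i) (\<lambda>y. f (x(i := y)))"
    if "x \<in> space (Pi\<^sub>M J M)" for x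
    by (rule M.integrable_const_bound[where B = K])
      (use that section_measurable insert.prems(2) upd in auto)
  have g_bound: "\<bar>g x\<bar> \<le> K" if x: "x \<in> space (Pi\<^sub>M J M)" for x
  proof -
    have "\<bar>g x\<bar> \<le> (\<integral>y. \<bar>f (x(i := y))\<bar> \<partial>M i)"
      unfolding g_def by (rule integral_abs_bound)
    also have "\<dots> \<le> (\<integral>y. K \<partial>M i)"
      by (intro integral_mono integrable_abs section_integrable x)
        (use insert.prems(2) upd x in auto)
    finally show ?thesis
      by (simp add: M.prob_space)
  qed
  have g_diff: "\<bar>g (x(j := z)) - g x\<bar> \<le> c j"
    if x: "x \<in> space (Pi\<^sub>M J M)" and j: "j \<in> J" and z: "z \<in> space (M j)" for x j z
  proof -
    have x': "x(j := z) \<in> space (Pi\<^sub>M J M)"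
      using x j z by (auto simp: space_PiM PiE_iff extensional_def)
    have "\<bar>g (x(j := z)) - g x\<bar> = \<bar>\<integral>y. f (x(j := z, i := y)) - f (x(i := y)) \<partial>M i\<bar>"
      unfolding g_def using section_integrable[OF x] section_integrable[OF x'] by simp
    also have "\<dots> \<le> (\<integral>y. \<bar>f (x(j := z, i := y)) - f (x(i := y))\<bar> \<partial>M i)"
      by (rule integral_abs_bound)
    also have "\<dots> \<le> (\<integral>y. c j \<partial>M i)"
    proof (intro integral_mono integrable_abs Bochner_Integration.integrable_diff
        section_integrable x x')
      fix y assume "y \<in> space (M i)"
      then show "\<bar>f (x(j := z, i := y)) - f (x(i := y))\<bar> \<le> c j"
        using insert.prems(3)[OF upd[OF x], of y j z] j z \<open>i \<notin> J\<close>
        by (metis fun_upd_twist insertCI)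
    qed simp
    finally show ?thesis
      by (simp add: M.prob_space)
  qed
  have "(\<integral>\<^sup>+x. exp (s * f x) \<partial>Pi\<^sub>M (insert i J) M)
      = (\<integral>\<^sup>+x. (\<integral>\<^sup>+y. exp (s * f (x(i := y))) \<partial>M i) \<partial>Pi\<^sub>M J M)"
    using insert.hyps by (intro product_nn_integral_insert) measurable
  also have "\<dots> \<le> (\<integral>\<^sup>+x. ennreal (exp (s * g x + s\<^sup>2 * (c i)\<^sup>2 / 8)) \<partial>Pi\<^sub>M J M)"
  proof (intro nn_integral_mono)
    fix x assume x: "x \<in> space (Pi\<^sub>M J M)"
    show "(\<integral>\<^sup>+y. exp (s * f (x(i := y))) \<partial>M i) \<le> ennreal (exp (s * g x + s\<^sup>2 * (c i)\<^sup>2 / 8))"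
      unfolding g_def
    proof (rule M.Hoeffdings_lemma_oscillation[OF section_measurable[OF x] _ s])
      fix y y' assume y: "y \<in> space (M i)" "y' \<in> space (M i)"
      \<comment> \<open>The difference hypothesis speaks of points of the larger product, so
        \<open>x\<close>, which has no coordinate \<open>i\<close> yet, is first extended by
        \<open>y'\<close> and then updated to \<open>y\<close>.\<close>
      have "\<bar>f (x(i := y', i := y)) - f (x(i := y'))\<bar> \<le> c i"
        by (rule insert.prems(3)[OF upd[OF x y(2)] insertI1 y(1)])
      then show "f (x(i := y)) - f (x(i := y')) \<le> c i"
        by (simp only: fun_upd_upd abs_le_iff)
    qed
  qed
  also have "\<dots> = (\<integral>\<^sup>+x. ennreal (exp (s\<^sup>2 * (c i)\<^sup>2 / 8)) * ennreal (exp (s * g x)) \<partial>Pi\<^sub>M J M)"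
    by (simp flip: ennreal_mult' exp_add add: add.commute)
  also have "\<dots> = ennreal (exp (s\<^sup>2 * (c i)\<^sup>2 / 8)) * (\<integral>\<^sup>+x. ennreal (exp (s * g x)) \<partial>Pi\<^sub>M J M)"
    by (rule nn_integral_cmult) measurable
  also have "\<dots> \<le> ennreal (exp (s\<^sup>2 * (c i)\<^sup>2 / 8))
      * ennreal (exp (s * (\<integral>x. g x \<partial>Pi\<^sub>M J M) + s\<^sup>2 * (\<Sum>i\<in>J. (c i)\<^sup>2) / 8))"
    by (intro mult_left_mono insert.IH g_measurable g_bound g_diff) simp_all
  also have "(\<integral>x. g x \<partial>Pi\<^sub>M J M) = (\<integral>x. f x \<partial>Pi\<^sub>M (insert i J) M)"
    unfolding g_def
    by (rule product_integral_insert[symmetric])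
      (use insert in \<open>auto intro!: iJ.integrable_const_bound[where B = K]\<close>)
  finally show ?case
    using insert.hyps
    by (simp flip: ennreal_mult' exp_add add: algebra_simps add_divide_distrib)
qed

text \<open>For \<open>(\<Sum>i\<in>I. (c i)\<^sup>2) = 0\<close> the bound is trivial, the exponent being \<open>_ / 0 = 0\<close>.\<close>

theorem (in product_prob_space) McDiarmid_inequality_ge:
  fixes f :: "('i \<Rightarrow> 'a) \<Rightarrow> real" and c :: "'i \<Rightarrow> real"
  assumes I: "finite I" and f [measurable]: "f \<in> borel_measurable (Pi\<^sub>M I M)"
    and bounded: "\<And>x. x \<in> space (Pi\<^sub>M I M) \<Longrightarrow> \<bar>f x\<bar> \<le> K"
    and diff: "\<And>x i z. x \<in> space (Pi\<^sub>M I M) \<Longrightarrow> i \<in> I \<Longrightarrow> z \<in> space (M i)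
        \<Longrightarrow> \<bar>f (x(i := z)) - f x\<bar> \<le> c i"
    and \<epsilon>: "0 \<le> \<epsilon>"
  shows "measure (Pi\<^sub>M I M) {x \<in> space (Pi\<^sub>M I M). f x \<ge> (\<integral>x. f x \<partial>Pi\<^sub>M I M) + \<epsilon>}
    \<le> exp (- 2 * \<epsilon>\<^sup>2 / (\<Sum>i\<in>I. (c i)\<^sup>2))"
proof -
  define V where "V = (\<Sum>i\<in>I. (c i)\<^sup>2)"
  define \<mu> where "\<mu> = (\<integral>x. f x \<partial>Pi\<^sub>M I M)"
  show ?thesis
  proof (cases "V = 0 \<or> \<epsilon> = 0")
    case True
    then show ?thesis
      by (auto simp: V_def[symmetric])
  next
    case False
    moreover have "0 \<le> V"
      unfolding V_def by (intro sum_nonneg) simp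
    ultimately have V: "0 < V" and \<epsilon>': "0 < \<epsilon>"
      using \<epsilon> by auto
    \<comment> \<open>This is the minimizer of the Chernoff exponent s^2 V / 8 - s
      \<epsilon>.\<close>
    define s where "s = 4 * \<epsilon> / V"
    have s: "0 < s"
      unfolding s_def using V \<epsilon>' by simp
    let ?u = "\<lambda>x. exp (s * f x)"
    have int: "integrable (Pi\<^sub>M I M) ?u"
      by (rule P.integrable_const_bound[where B = "exp (s * K)"])
        (use bounded s in \<open>fastforce simp: abs_le_iff\<close>)+
    have "ennreal (\<integral>x. ?u x \<partial>Pi\<^sub>M I M) = (\<integral>\<^sup>+x. ?u x \<partial>Pi\<^sub>M I M)"
      by (rule nn_integral_eq_integral[symmetric, OF int]) simp
    also have "\<dots> \<le> ennreal (exp (s * \<mu> + s\<^sup>2 * V / 8))"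
      unfolding \<mu>_def V_def using bounded diff by (intro mgf_bounded_differences[OF I f _ _ s])
    finally have mgf: "(\<integral>x. ?u x \<partial>Pi\<^sub>M I M) \<le> exp (s * \<mu> + s\<^sup>2 * V / 8)"
      by simp
    have "{x \<in> space (Pi\<^sub>M I M). f x \<ge> \<mu> + \<epsilon>} = {x \<in> space (Pi\<^sub>M I M). ?u x \<ge> exp (s * (\<mu> + \<epsilon>))}"
      using s by simp
    then have "P.prob {x \<in> space (Pi\<^sub>M I M). f x \<ge> \<mu> + \<epsilon>}
        \<le> (\<integral>x. ?u x \<partial>Pi\<^sub>M I M) / exp (s * (\<mu> + \<epsilon>))"
      using integral_Markov_inequality_measure[OF int sets.empty_sets, of "exp (s * (\<mu> + \<epsilon>))"] by simp
    also have "\<dots> \<le> exp (s * \<mu> + s\<^sup>2 * V / 8) / exp (s * (\<mu> + \<epsilon>))"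
      using mgf by (intro divide_right_mono) simp_all
    also have "\<dots> = exp (s\<^sup>2 * V / 8 - s * \<epsilon>)"
      by (simp flip: exp_diff add: algebra_simps)
    also have "s\<^sup>2 * V / 8 - s * \<epsilon> = - 2 * \<epsilon>\<^sup>2 / V"
      unfolding s_def using V by (simp add: power2_eq_square field_simps)
    finally show ?thesis
      unfolding \<mu>_def V_def .
  qed
qed

section \<open>Symmetrization\<close>

text \<open>Restriction to \<open>{..<m}\<close> keeps the result in the extensional product space.
  The other half of the exchanged pair is \<open>swap_by_sign m \<sigma> S' S\<close>.\<close>

definition swap_by_sign :: "nat \<Rightarrow> (nat \<Rightarrow> real) \<Rightarrow> (nat \<Rightarrow> 'a) \<Rightarrow> (nat \<Rightarrow> 'a) \<Rightarrow> nat \<Rightarrow> 'a" where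
  "swap_by_sign m \<sigma> S S' = (\<lambda>i\<in>{..<m}. if \<sigma> i = 1 then S i else S' i)"

text \<open>The default 0 outside \<open>{..<m}\<close> makes the set finite, matches the
  \<open>Pi_pmf\<close> of the Rademacher complexity and is preserved by negation.\<close>

abbreviation sign_vectors :: "nat \<Rightarrow> (nat \<Rightarrow> real) set" where
  "sign_vectors m \<equiv> PiE_dflt {..<m} 0 (\<lambda>_. {-1, 1})"

lemma finite_sign_vectors: "finite (sign_vectors m)"
  by (rule finite_PiE_dflt) auto

lemma sign_vectorsD: "\<sigma> \<in> sign_vectors m \<Longrightarrow> i < m \<Longrightarrow> \<sigma> i = -1 \<or> \<sigma> i = 1"
  by (auto simp: PiE_dflt_def)

lemma uminus_sign_vectors: "\<sigma> \<in> sign_vectors m \<Longrightarrow> - \<sigma> \<in> sign_vectors m"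
  by (auto simp: PiE_dflt_def)

lemma sum_sign_vectors_uminus: "(\<Sum>\<sigma>\<in>sign_vectors m. f (- \<sigma>)) = (\<Sum>\<sigma>\<in>sign_vectors m. f \<sigma>)"
  by (rule sum.reindex_bij_witness[of _ uminus uminus]) (auto intro: uminus_sign_vectors)

definition sign_average :: "nat \<Rightarrow> ((nat \<Rightarrow> real) \<Rightarrow> real) \<Rightarrow> real" where
  "sign_average m f = (\<Sum>\<sigma>\<in>sign_vectors m. f \<sigma>) / card (sign_vectors m)"

lemma card_sign_vectors_pos: "0 < card (sign_vectors m)"
  by (simp add: card_gt_0_iff finite_sign_vectors)

lemma abs_sign_average_le:
  assumes "\<And>\<sigma>. \<sigma> \<in> sign_vectors m \<Longrightarrow> \<bar>f \<sigma>\<bar> \<le> c"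
  shows "\<bar>sign_average m f\<bar> \<le> c"
proof -
  have "\<bar>\<Sum>\<sigma>\<in>sign_vectors m. f \<sigma>\<bar> \<le> (\<Sum>\<sigma>\<in>sign_vectors m. c)"
    by (rule order_trans[OF sum_abs sum_mono]) (rule assms)
  then show ?thesis
    using card_sign_vectors_pos[of m] by (simp add: sign_average_def field_simps)
qed

lemma le_sign_average:
  assumes "\<And>\<sigma>. \<sigma> \<in> sign_vectors m \<Longrightarrow> c \<le> f \<sigma>"
  shows "c \<le> sign_average m f"
  using sum_mono[of "sign_vectors m" "\<lambda>_. c" f] assms card_sign_vectors_pos[of m]
  by (simp add: sign_average_def field_simps)

lemma sign_average_diff:
  "sign_average m f - sign_average m g = sign_average m (\<lambda>\<sigma>. f \<sigma> - g \<sigma>)"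
  by (simp add: sign_average_def sum_subtractf diff_divide_distrib)

lemma expectation_signs:
  "measure_pmf.expectation (Pi_pmf {..<m} 0 (\<lambda>_. pmf_of_set {-1, 1})) f
    = (\<Sum>\<sigma>\<in>sign_vectors m. f \<sigma>) / card (sign_vectors m)"
  by (subst Pi_pmf_of_set)
    (auto intro!: integral_pmf_of_set finite_sign_vectors)

text \<open>Every sign is -1 or 1, so negation reverses each choice between the samples. Thus the
  second half of an exchanged pair is the first half for \<open>- \<sigma>\<close>, and facts about
  one half serve for both.\<close>

lemma swap_by_sign_uminus:
  assumes "\<sigma> \<in> sign_vectors m"
  shows "swap_by_sign m (- \<sigma>) S S' = swap_by_sign m \<sigma> S' S"
  using sign_vectorsD[OF assms] by (fastforce simp: swap_by_sign_def)

lemma measurable_swap_by_sign [measurable]: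
  "(\<lambda>(S, S'). swap_by_sign m \<sigma> S S') \<in> Pi\<^sub>M {..<m} M \<Otimes>\<^sub>M Pi\<^sub>M {..<m} M \<rightarrow>\<^sub>M Pi\<^sub>M {..<m} M"
  unfolding swap_by_sign_def case_prod_beta'
  by (rule measurable_restrict) measurable

lemma swap_by_sign_in_space:
  "S \<in> space (Pi\<^sub>M {..<m} M) \<Longrightarrow> S' \<in> space (Pi\<^sub>M {..<m} M)
    \<Longrightarrow> swap_by_sign m \<sigma> S S' \<in> space (Pi\<^sub>M {..<m} M)"
  by (auto simp: swap_by_sign_def space_PiM PiE_iff)

text \<open>A changed point of \<open>S\<close> enters just one of the two exchanged samples, and
  the sign at \<open>i\<close> decides which. With the mirror image below, this makes the sum of the
  two Rademacher suprema vary by \<open>B / m\<close> and not by twice that.\<close>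

lemma swap_by_sign_fun_upd_left:
  assumes "i < m"
  shows "swap_by_sign m \<sigma> (S(i := z)) S' =
    (if \<sigma> i = 1 then (swap_by_sign m \<sigma> S S')(i := z) else swap_by_sign m \<sigma> S S')"
  using assms by (auto simp: swap_by_sign_def fun_eq_iff)

lemma swap_by_sign_fun_upd_right:
  assumes "i < m"
  shows "swap_by_sign m \<sigma> S' (S(i := z)) =
    (if \<sigma> i = 1 then swap_by_sign m \<sigma> S' S else (swap_by_sign m \<sigma> S' S)(i := z))"
  using assms by (auto simp: swap_by_sign_def fun_eq_iff)

text \<open>All coordinates of both samples are independent with law \<open>D\<close>, so choosing
  one of the two at each index again gives an i.i.d. sample. It is enough to check
  rectangles.\<close>

lemma distr_swap_by_sign:
  fixes D :: "'a measure"
  assumes "prob_space D"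
  shows "distr (Pi\<^sub>M {..<m} (\<lambda>_. D) \<Otimes>\<^sub>M Pi\<^sub>M {..<m} (\<lambda>_. D)) (Pi\<^sub>M {..<m} (\<lambda>_. D))
      (\<lambda>(S, S'). swap_by_sign m \<sigma> S S') = Pi\<^sub>M {..<m} (\<lambda>_. D)"
    (is "distr (?P \<Otimes>\<^sub>M ?P) _ ?sw = _")
proof -
  interpret D: prob_space D
    by fact
  interpret P: product_prob_space "\<lambda>_ :: nat. D" "{..<m}"
    by unfold_locales
  show ?thesis
  proof (rule P.PiM_eqI)
    fix A :: "nat \<Rightarrow> _" assume A: "\<And>i. i \<in> {..<m} \<Longrightarrow> A i \<in> sets D"
    \<comment> \<open>The preimage of a rectangle is a product of two rectangles: at each index the
      chosen sample is constrained by \<open>A i\<close> and the other one by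
      \<open>space D\<close>, a factor of measure 1.\<close>
    let ?A1 = "\<lambda>i. if \<sigma> i = 1 then A i else space D"
    let ?A2 = "\<lambda>i. if \<sigma> i = 1 then space D else A i"
    have A12: "?A1 i \<in> sets D" "?A2 i \<in> sets D" if "i \<in> {..<m}" for i
      using A[OF that] by simp_all
    have space: "a \<in> A i \<Longrightarrow> i < m \<Longrightarrow> a \<in> space D" for a i
      using A sets.sets_into_space by blast
    have "emeasure (distr (?P \<Otimes>\<^sub>M ?P) ?P ?sw) (Pi\<^sub>E {..<m} A)
        = emeasure (?P \<Otimes>\<^sub>M ?P) (?sw -` Pi\<^sub>E {..<m} A \<inter> space (?P \<Otimes>\<^sub>M ?P))"
      using A by (intro emeasure_distr measurable_swap_by_sign sets_PiM_I_finite) auto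
    also have "?sw -` Pi\<^sub>E {..<m} A \<inter> space (?P \<Otimes>\<^sub>M ?P) = Pi\<^sub>E {..<m} ?A1 \<times> Pi\<^sub>E {..<m} ?A2"
    proof (rule set_eqI)
      fix q :: "(nat \<Rightarrow> 'a) \<times> (nat \<Rightarrow> 'a)"
      obtain S S' where q: "q = (S, S')"
        by (cases q)
      have "S i \<in> space D \<and> S' i \<in> space D \<and> (if \<sigma> i = 1 then S i else S' i) \<in> A i
          \<longleftrightarrow> S i \<in> ?A1 i \<and> S' i \<in> ?A2 i" if "i \<in> {..<m}" for i
        using space[of _ i] that by (cases "\<sigma> i = 1") auto
      then show "q \<in> ?sw -` Pi\<^sub>E {..<m} A \<inter> space (?P \<Otimes>\<^sub>M ?P) \<longleftrightarrow> q \<in> Pi\<^sub>E {..<m} ?A1 \<times> Pi\<^sub>E {..<m} ?A2"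
        unfolding q space_pair_measure space_PiM swap_by_sign_def
        by (simp only: vimage_eq Int_iff mem_Times_iff prod.case fst_conv snd_conv PiE_iff
            restrict_apply' restrict_extensional cong: ball_cong) blast
    qed
    also have "emeasure (?P \<Otimes>\<^sub>M ?P) \<dots> = emeasure ?P (Pi\<^sub>E {..<m} ?A1) * emeasure ?P (Pi\<^sub>E {..<m} ?A2)"
      using A12 by (intro P.P.emeasure_pair_measure_Times sets_PiM_I_finite) auto
    also have "\<dots> = (\<Prod>i<m. emeasure D (?A1 i)) * (\<Prod>i<m. emeasure D (?A2 i))"
      using A12 by (intro arg_cong2[where f = times] P.emeasure_PiM finite_lessThan)
    also have "\<dots> = (\<Prod>i<m. emeasure D (A i))"
      unfolding prod.distrib[symmetric] by (intro prod.cong) (auto simp: D.emeasure_space_1)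
    finally show "emeasure (distr (?P \<Otimes>\<^sub>M ?P) ?P ?sw) (Pi\<^sub>E {..<m} A) = (\<Prod>i<m. emeasure D (A i))" .
  qed simp_all
qed

section \<open>Bounded loss classes and their Rademacher suprema\<close>

text \<open>\<open>H\<close> may be uncountable, so measurability of a supremum over it has to be
  assumed. It is assumed only for Rademacher suprema of a single sample with signs -1 and 1; the
  argument is arranged so that no other supremum over \<open>H\<close> is integrated.\<close>

locale bounded_loss_class = prob_space D for D :: "('x \<times> nat) measure" +
  fixes m :: nat and H :: "'x hyp set" and l :: "'x loss" and B :: real
  assumes m: "1 \<le> m"
    and H_nonempty: "H \<noteq> {}"
    and loss_measurable: "\<And>h. h \<in> H \<Longrightarrow> (\<lambda>(x, y). l h x y) \<in> borel_measurable D"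
    and loss_bounded: "\<And>h x y. h \<in> H \<Longrightarrow> (x, y) \<in> space D \<Longrightarrow> 0 \<le> l h x y \<and> l h x y \<le> B"
    and rademacher_sup_measurable:
      "\<And>\<sigma>. (\<And>i. i < m \<Longrightarrow> \<sigma> i \<in> {-1, 1})
        \<Longrightarrow> rademacher_sup m l H \<sigma> \<in> borel_measurable (iid_sample D m)"
begin

abbreviation sample_space :: "'x sample measure" where
  "sample_space \<equiv> iid_sample D m"

definition point_loss :: "'x hyp \<Rightarrow> 'x \<times> nat \<Rightarrow> real" where
  "point_loss h z = l h (fst z) (snd z)"

sublocale samples: prob_space sample_space
  by (rule prob_space_PiM) (rule prob_space_axioms)

sublocale coords: product_prob_space "\<lambda>_ :: nat. D" "{..<m}"
  by unfold_locales

sublocale sample_pairs: pair_prob_space sample_space sample_space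
  by unfold_locales

lemma point_loss_bounded: "h \<in> H \<Longrightarrow> z \<in> space D \<Longrightarrow> 0 \<le> point_loss h z \<and> point_loss h z \<le> B"
  using loss_bounded[of h "fst z" "snd z"] by (simp add: point_loss_def)

lemma point_loss_measurable: "h \<in> H \<Longrightarrow> point_loss h \<in> borel_measurable D"
  using loss_measurable[of h] unfolding point_loss_def case_prod_beta' .

lemma B_nonneg: "0 \<le> B"
  using point_loss_bounded not_empty H_nonempty by fastforce

lemma risk_eq: "risk D l h = expectation (point_loss h)"
  by (simp add: risk_def point_loss_def[abs_def] case_prod_beta')

lemma sample_in_space: "S \<in> space sample_space \<Longrightarrow> i < m \<Longrightarrow> S i \<in> space D"
  by (auto simp: space_PiM)

lemma sample_upd: "S \<in> space sample_space \<Longrightarrow> i < m \<Longrightarrow> z \<in> space D \<Longrightarrow> S(i := z) \<in> space sample_space"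
  by (auto simp: space_PiM PiE_iff extensional_def)

definition signed_mean :: "(nat \<Rightarrow> real) \<Rightarrow> 'x sample \<Rightarrow> 'x hyp \<Rightarrow> real" where
  "signed_mean \<sigma> S h = (1 / real m) * (\<Sum>i<m. \<sigma> i * point_loss h (S i))"

lemma rademacher_sup_eq: "rademacher_sup m l H \<sigma> S = (SUP h\<in>H. signed_mean \<sigma> S h)"
  by (simp add: rademacher_sup_def signed_mean_def point_loss_def)

lemma signed_mean_bounded:
  assumes \<sigma>: "\<sigma> \<in> sign_vectors m" and S: "S \<in> space sample_space" and h: "h \<in> H"
  shows "\<bar>signed_mean \<sigma> S h\<bar> \<le> B"
proof -
  have "\<bar>\<Sum>i<m. \<sigma> i * point_loss h (S i)\<bar> \<le> (\<Sum>i<m. B)"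
  proof (rule order_trans[OF sum_abs sum_mono])
    fix i assume "i \<in> {..<m}"
    then show "\<bar>\<sigma> i * point_loss h (S i)\<bar> \<le> B"
      using sign_vectorsD[OF \<sigma>, of i] point_loss_bounded[OF h sample_in_space[OF S], of i]
      by (auto simp: abs_mult)
  qed
  then show ?thesis
    using m by (simp add: signed_mean_def abs_mult field_simps)
qed

lemma signed_mean_le_rademacher_sup:
  assumes \<sigma>: "\<sigma> \<in> sign_vectors m" and S: "S \<in> space sample_space" and h: "h \<in> H"
  shows "signed_mean \<sigma> S h \<le> rademacher_sup m l H \<sigma> S"
  unfolding rademacher_sup_eq
  by (intro cSUP_upper h bdd_aboveI2[of _ _ B])
    (use signed_mean_bounded[OF \<sigma> S] in \<open>auto simp: abs_le_iff\<close>)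

lemma rademacher_sup_bounded:
  assumes \<sigma>: "\<sigma> \<in> sign_vectors m" and S: "S \<in> space sample_space"
  shows "\<bar>rademacher_sup m l H \<sigma> S\<bar> \<le> B"
proof -
  have "rademacher_sup m l H \<sigma> S \<le> B"
    unfolding rademacher_sup_eq
    by (intro cSUP_least H_nonempty) (use signed_mean_bounded[OF \<sigma> S] in \<open>auto simp: abs_le_iff\<close>)
  moreover obtain h where h: "h \<in> H"
    using H_nonempty by blast
  ultimately show ?thesis
    using signed_mean_le_rademacher_sup[OF \<sigma> S h] signed_mean_bounded[OF \<sigma> S h] by linarith
qed

text \<open>For each \<open>h\<close> the signed mean moves by a sign times a difference of two
  losses, divided by \<open>m\<close>. Both losses lie between 0 and \<open>B\<close>, so their
  difference is at most \<open>B\<close> in absolute value, and the bound passes to the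
  supremum.\<close>

lemma rademacher_sup_upd_le:
  assumes \<sigma>: "\<sigma> \<in> sign_vectors m" and S: "S \<in> space sample_space"
    and i: "i < m" and z: "z \<in> space D"
  shows "rademacher_sup m l H \<sigma> (S(i := z)) \<le> rademacher_sup m l H \<sigma> S + B / m"
  unfolding rademacher_sup_eq[of \<sigma> "S(i := z)"]
proof (intro cSUP_least H_nonempty)
  fix h assume h: "h \<in> H"
  have "(\<Sum>j<m. \<sigma> j * point_loss h ((S(i := z)) j))
      = (\<Sum>j<m. \<sigma> j * point_loss h (S j)) + \<sigma> i * (point_loss h z - point_loss h (S i))"
    using i by (simp add: sum.remove[of "{..<m}" i] algebra_simps)
  then have "signed_mean \<sigma> (S(i := z)) h
      = signed_mean \<sigma> S h + \<sigma> i * (point_loss h z - point_loss h (S i)) / m"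
    by (simp add: signed_mean_def add_divide_distrib)
  moreover have "\<sigma> i * (point_loss h z - point_loss h (S i)) \<le> B"
    using sign_vectorsD[OF \<sigma> i] point_loss_bounded[OF h z]
      point_loss_bounded[OF h sample_in_space[OF S i]] by auto
  then have "\<sigma> i * (point_loss h z - point_loss h (S i)) / m \<le> B / m"
    by (rule divide_right_mono) simp
  moreover note signed_mean_le_rademacher_sup[OF \<sigma> S h]
  ultimately show "signed_mean \<sigma> (S(i := z)) h \<le> rademacher_sup m l H \<sigma> S + B / m"
    by linarith
qed

lemma rademacher_sup_bounded_difference:
  assumes \<sigma>: "\<sigma> \<in> sign_vectors m" and S: "S \<in> space sample_space"
    and i: "i < m" and z: "z \<in> space D"
  shows "\<bar>rademacher_sup m l H \<sigma> (S(i := z)) - rademacher_sup m l H \<sigma> S\<bar> \<le> B / m"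
  \<comment> \<open>The reverse inequality is the same lemma at the updated sample, with the
    original point \<open>S i\<close> put back.\<close>
  using rademacher_sup_upd_le[OF \<sigma> S i z]
    rademacher_sup_upd_le[OF \<sigma> sample_upd[OF S i z] i sample_in_space[OF S i]]
  by (simp add: abs_le_iff)

lemma rademacher_sup_borel:
  assumes "\<sigma> \<in> sign_vectors m"
  shows "rademacher_sup m l H \<sigma> \<in> borel_measurable sample_space"
  using sign_vectorsD[OF assms] by (intro rademacher_sup_measurable) auto

lemma rademacher_sup_integrable:
  assumes "\<sigma> \<in> sign_vectors m"
  shows "integrable sample_space (rademacher_sup m l H \<sigma>)"
  by (rule samples.integrable_const_bound[where B = B])
    (use assms rademacher_sup_bounded rademacher_sup_borel in auto)

lemma rademacher_complexity_eq:
  "rademacher_complexity D m l H =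
    (\<Sum>\<sigma>\<in>sign_vectors m. \<integral>S. rademacher_sup m l H \<sigma> S \<partial>sample_space) / card (sign_vectors m)"
  unfolding rademacher_complexity_def expectation_signs
  by (simp add: rademacher_sup_integrable)

section \<open>Rademacher suprema of the two exchanged samples\<close>

text \<open>Both halves of the exchanged pair carry the same signs. The four suprema that will bound
  an excess risk regroup into the values of this function at \<open>\<sigma>\<close> and
  \<open>- \<sigma>\<close>.\<close>

definition swapped_sup :: "(nat \<Rightarrow> real) \<Rightarrow> 'x sample \<Rightarrow> 'x sample \<Rightarrow> real" where
  "swapped_sup \<sigma> S S' = rademacher_sup m l H \<sigma> (swap_by_sign m \<sigma> S S')
    + rademacher_sup m l H \<sigma> (swap_by_sign m \<sigma> S' S)"

lemma measurable_swapped_sup: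
  assumes "\<sigma> \<in> sign_vectors m"
  shows "(\<lambda>(S, S'). swapped_sup \<sigma> S S') \<in> borel_measurable (sample_space \<Otimes>\<^sub>M sample_space)"
proof -
  note sw = measurable_swap_by_sign[of m \<sigma> "\<lambda>_. D", unfolded case_prod_beta']
  have 1: "(\<lambda>p. rademacher_sup m l H \<sigma> (swap_by_sign m \<sigma> (fst p) (snd p)))
      \<in> borel_measurable (sample_space \<Otimes>\<^sub>M sample_space)"
    by (rule measurable_compose[OF sw rademacher_sup_borel[OF assms]])
  have 2: "(\<lambda>p. rademacher_sup m l H \<sigma> (swap_by_sign m \<sigma> (snd p) (fst p)))
      \<in> borel_measurable (sample_space \<Otimes>\<^sub>M sample_space)"
    using measurable_compose[OF measurable_pair_swap' 1[unfolded case_prod_beta']]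
    by (simp add: case_prod_beta')
  show ?thesis
    unfolding swapped_sup_def case_prod_beta' using 1 2 by (rule borel_measurable_add)
qed


lemma swapped_sup_bounded:
  assumes "\<sigma> \<in> sign_vectors m" "S \<in> space sample_space" "S' \<in> space sample_space"
  shows "\<bar>swapped_sup \<sigma> S S'\<bar> \<le> 2 * B"
  using rademacher_sup_bounded[OF assms(1) swap_by_sign_in_space[OF assms(2,3), of \<sigma>]]
    rademacher_sup_bounded[OF assms(1) swap_by_sign_in_space[OF assms(3,2), of \<sigma>]]
  unfolding swapped_sup_def by linarith

lemma swapped_sup_pair_integrable:
  assumes "\<sigma> \<in> sign_vectors m"
  shows "integrable (sample_space \<Otimes>\<^sub>M sample_space) (\<lambda>(S, S'). swapped_sup \<sigma> S S')"
  by (rule sample_pairs.integrable_const_bound[where B = "2 * B"])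
    (use assms measurable_swapped_sup swapped_sup_bounded in \<open>auto simp: space_pair_measure\<close>)

lemma swapped_sup_section_integrable:
  assumes "\<sigma> \<in> sign_vectors m" "S \<in> space sample_space"
  shows "integrable sample_space (swapped_sup \<sigma> S)"
proof (rule samples.integrable_const_bound[where B = "2 * B"])
  show "swapped_sup \<sigma> S \<in> borel_measurable sample_space"
    using measurable_Pair2[OF measurable_swapped_sup[OF assms(1)] assms(2)] by simp
qed (use assms swapped_sup_bounded in auto)

lemma measurable_integral_swapped_sup:
  assumes "\<sigma> \<in> sign_vectors m"
  shows "(\<lambda>S. \<integral>S'. swapped_sup \<sigma> S S' \<partial>sample_space) \<in> borel_measurable sample_space"
  by (rule samples.borel_measurable_lebesgue_integral) (rule measurable_swapped_sup[OF assms])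

lemma integral_swapped_sup_bounded:
  assumes "\<sigma> \<in> sign_vectors m" "S \<in> space sample_space"
  shows "\<bar>\<integral>S'. swapped_sup \<sigma> S S' \<partial>sample_space\<bar> \<le> 2 * B"
proof -
  have "\<bar>\<integral>S'. swapped_sup \<sigma> S S' \<partial>sample_space\<bar> \<le> (\<integral>S'. \<bar>swapped_sup \<sigma> S S'\<bar> \<partial>sample_space)"
    by (rule integral_abs_bound)
  also have "\<dots> \<le> (\<integral>S'. 2 * B \<partial>sample_space)"
    by (intro integral_mono integrable_abs swapped_sup_section_integrable assms)
      (use assms swapped_sup_bounded in auto)
  finally show ?thesis
    by (simp add: samples.prob_space)
qed

text \<open>Change of variables along \<open>distr_swap_by_sign\<close>. The exchange pattern
  \<open>\<tau>\<close> is kept apart from the signs \<open>\<sigma>\<close> since it is used both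
  as \<open>\<sigma>\<close> and as \<open>- \<sigma>\<close>.\<close>

lemma rademacher_sup_swap_integral:
  assumes "\<sigma> \<in> sign_vectors m"
  shows "integrable (sample_space \<Otimes>\<^sub>M sample_space)
      (\<lambda>(S, S'). rademacher_sup m l H \<sigma> (swap_by_sign m \<tau> S S'))" (is ?int)
    and "(\<integral>(S, S'). rademacher_sup m l H \<sigma> (swap_by_sign m \<tau> S S') \<partial>(sample_space \<Otimes>\<^sub>M sample_space))
      = (\<integral>S. rademacher_sup m l H \<sigma> S \<partial>sample_space)" (is ?eq)
proof -
  note distr = distr_swap_by_sign[OF prob_space_axioms, of m \<tau>]
  have "integrable (distr (sample_space \<Otimes>\<^sub>M sample_space) sample_space
      (\<lambda>(S, S'). swap_by_sign m \<tau> S S')) (rademacher_sup m l H \<sigma>)"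
    unfolding distr by (rule rademacher_sup_integrable[OF assms])
  then show ?int
    by (subst (asm) integrable_distr_eq[OF measurable_swap_by_sign rademacher_sup_borel[OF assms]])
      (simp add: case_prod_beta')
  have "(\<integral>S. rademacher_sup m l H \<sigma> S \<partial>distr (sample_space \<Otimes>\<^sub>M sample_space) sample_space
      (\<lambda>(S, S'). swap_by_sign m \<tau> S S')) =
    (\<integral>(S, S'). rademacher_sup m l H \<sigma> (swap_by_sign m \<tau> S S') \<partial>(sample_space \<Otimes>\<^sub>M sample_space))"
    by (subst integral_distr[OF measurable_swap_by_sign rademacher_sup_borel[OF assms]])
      (simp add: case_prod_beta')
  then show ?eq
    unfolding distr by simp
qed

lemma integral_integral_swapped_sup:
  assumes "\<sigma> \<in> sign_vectors m"
  shows "(\<integral>S. \<integral>S'. swapped_sup \<sigma> S S' \<partial>sample_space \<partial>sample_space)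
    = 2 * (\<integral>S. rademacher_sup m l H \<sigma> S \<partial>sample_space)"
proof -
  have "(\<integral>S. \<integral>S'. swapped_sup \<sigma> S S' \<partial>sample_space \<partial>sample_space)
      = (\<integral>(S, S'). swapped_sup \<sigma> S S' \<partial>(sample_space \<Otimes>\<^sub>M sample_space))"
    using sample_pairs.integral_fst'[OF swapped_sup_pair_integrable[OF assms]]
    by (simp add: case_prod_beta')
  \<comment> \<open>Negating the exchange pattern restores the order of the pair in the second
    summand, so both summands have the form treated above.\<close>
  also have "\<dots> = (\<integral>p. (case p of (S, S') \<Rightarrow> rademacher_sup m l H \<sigma> (swap_by_sign m \<sigma> S S'))
      + (case p of (S, S') \<Rightarrow> rademacher_sup m l H \<sigma> (swap_by_sign m (- \<sigma>) S S'))
      \<partial>(sample_space \<Otimes>\<^sub>M sample_space))"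
    by (simp add: swapped_sup_def swap_by_sign_uminus[OF assms] case_prod_beta')
  also have "\<dots> = 2 * (\<integral>S. rademacher_sup m l H \<sigma> S \<partial>sample_space)"
    by (subst Bochner_Integration.integral_add)
      (simp_all only: rademacher_sup_swap_integral[OF assms] mult_2)
  finally show ?thesis .
qed

lemma swapped_sup_bounded_difference:
  assumes \<sigma>: "\<sigma> \<in> sign_vectors m" and S: "S \<in> space sample_space" and S': "S' \<in> space sample_space"
    and i: "i < m" and z: "z \<in> space D"
  shows "\<bar>swapped_sup \<sigma> (S(i := z)) S' - swapped_sup \<sigma> S S'\<bar> \<le> B / m"
  using rademacher_sup_bounded_difference[OF \<sigma> swap_by_sign_in_space[OF S S', of \<sigma>] i z]
    rademacher_sup_bounded_difference[OF \<sigma> swap_by_sign_in_space[OF S' S, of \<sigma>] i z]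
  by (simp add: swapped_sup_def swap_by_sign_fun_upd_left[OF i] swap_by_sign_fun_upd_right[OF i])

lemma integral_swapped_sup_bounded_difference:
  assumes \<sigma>: "\<sigma> \<in> sign_vectors m" and S: "S \<in> space sample_space"
    and i: "i < m" and z: "z \<in> space D"
  shows "\<bar>(\<integral>S'. swapped_sup \<sigma> (S(i := z)) S' \<partial>sample_space)
      - (\<integral>S'. swapped_sup \<sigma> S S' \<partial>sample_space)\<bar> \<le> B / m"
proof -
  note int = swapped_sup_section_integrable[OF \<sigma> S]
    swapped_sup_section_integrable[OF \<sigma> sample_upd[OF S i z]]
  have "\<bar>(\<integral>S'. swapped_sup \<sigma> (S(i := z)) S' \<partial>sample_space)
      - (\<integral>S'. swapped_sup \<sigma> S S' \<partial>sample_space)\<bar>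
    = \<bar>\<integral>S'. swapped_sup \<sigma> (S(i := z)) S' - swapped_sup \<sigma> S S' \<partial>sample_space\<bar>"
    using int by simp
  also have "\<dots> \<le> (\<integral>S'. \<bar>swapped_sup \<sigma> (S(i := z)) S' - swapped_sup \<sigma> S S'\<bar> \<partial>sample_space)"
    by (rule integral_abs_bound)
  also have "\<dots> \<le> (\<integral>S'. B / m \<partial>sample_space)"
    by (intro integral_mono integrable_abs Bochner_Integration.integrable_diff int)
      (use swapped_sup_bounded_difference[OF \<sigma> S _ i z] in auto)
  finally show ?thesis
    by (simp add: samples.prob_space)
qed

section \<open>The measurable majorant: range, differences and mean\<close>

text \<open>The factor 2 accounts for \<open>\<sigma>\<close> and \<open>- \<sigma>\<close>, which
  contribute equally to the average. Integrating out the ghost sample leaves a function of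
  \<open>S\<close> alone, to which McDiarmid's inequality applies.\<close>

definition ghost_deviation :: "'x sample \<Rightarrow> real" where
  "ghost_deviation S =
    2 * sign_average m (\<lambda>\<sigma>. \<integral>S'. swapped_sup \<sigma> S S' \<partial>sample_space)"

lemma measurable_ghost_deviation: "ghost_deviation \<in> borel_measurable sample_space"
  unfolding ghost_deviation_def[abs_def] sign_average_def
  by (intro borel_measurable_times borel_measurable_divide borel_measurable_sum
      measurable_integral_swapped_sup borel_measurable_const)

lemma ghost_deviation_bounded:
  assumes "S \<in> space sample_space"
  shows "\<bar>ghost_deviation S\<bar> \<le> 4 * B"
  using abs_sign_average_le[OF integral_swapped_sup_bounded[OF _ assms]]
  by (simp add: ghost_deviation_def abs_mult)

lemma ghost_deviation_bounded_difference:
  assumes "S \<in> space sample_space" "i < m" "z \<in> space D"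
  shows "\<bar>ghost_deviation (S(i := z)) - ghost_deviation S\<bar> \<le> 2 * B / m"
proof -
  have "\<bar>sign_average m (\<lambda>\<sigma>. (\<integral>S'. swapped_sup \<sigma> (S(i := z)) S' \<partial>sample_space)
      - (\<integral>S'. swapped_sup \<sigma> S S' \<partial>sample_space))\<bar> \<le> B / m"
    by (intro abs_sign_average_le integral_swapped_sup_bounded_difference assms)
  then show ?thesis
    by (simp add: ghost_deviation_def sign_average_diff abs_mult flip: right_diff_distrib)
qed

text \<open>One factor 2 is that of the definition; the other counts the two exchanged samples, each
  of which is distributed like \<open>S\<close>.\<close>

lemma expectation_ghost_deviation:
  "(\<integral>S. ghost_deviation S \<partial>sample_space) = 4 * rademacher_complexity D m l H"
proof -
  have int: "integrable sample_space (\<lambda>S. \<integral>S'. swapped_sup \<sigma> S S' \<partial>sample_space)"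
    if "\<sigma> \<in> sign_vectors m" for \<sigma>
    by (rule samples.integrable_const_bound[where B = "2 * B"])
      (use that measurable_integral_swapped_sup integral_swapped_sup_bounded in auto)
  show ?thesis
    unfolding ghost_deviation_def rademacher_complexity_eq sign_average_def
    by (simp add: int integral_integral_swapped_sup flip: sum_distrib_left)
qed

section \<open>Comparison of the excess risk with the majorant\<close>

lemma integral_point_loss_component:
  assumes "h \<in> H" "i < m"
  shows "integrable sample_space (\<lambda>S. point_loss h (S i))"
    and "(\<integral>S. point_loss h (S i) \<partial>sample_space) = risk D l h"
proof -
  have comp: "distr sample_space D (\<lambda>S. S i) = D"
    using assms(2) by (intro distr_PiM_component prob_space_axioms) simp
  have meas: "(\<lambda>S. S i) \<in> sample_space \<rightarrow>\<^sub>M D"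
    using assms(2) by (intro measurable_component_singleton) simp
  have "integrable D (point_loss h)"
    by (rule integrable_const_bound[where B = B])
      (use point_loss_bounded point_loss_measurable assms(1) in auto)
  then show "integrable sample_space (\<lambda>S. point_loss h (S i))"
    using integrable_distr_eq[OF meas point_loss_measurable[OF assms(1)]] by (simp add: comp)
  show "(\<integral>S. point_loss h (S i) \<partial>sample_space) = risk D l h"
    using integral_distr[OF meas point_loss_measurable[OF assms(1)]] by (simp add: comp risk_eq)
qed

lemma empirical_risk_eq: "empirical_risk m l S h = (1 / real m) * (\<Sum>i<m. point_loss h (S i))"
  by (simp add: empirical_risk_def point_loss_def)

lemma expectation_empirical_risk:
  assumes "h \<in> H"
  shows "integrable sample_space (\<lambda>S. empirical_risk m l S h)"
    and "(\<integral>S. empirical_risk m l S h \<partial>sample_space) = risk D l h"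
proof -
  show "integrable sample_space (\<lambda>S. empirical_risk m l S h)"
    unfolding empirical_risk_eq
    by (intro integrable_mult_right Bochner_Integration.integrable_sum
        integral_point_loss_component assms) simp
  have "(\<integral>S. empirical_risk m l S h \<partial>sample_space)
      = (1 / real m) * (\<Sum>i<m. \<integral>S. point_loss h (S i) \<partial>sample_space)"
    unfolding empirical_risk_eq using integral_point_loss_component(1)[OF assms] by simp
  then show "(\<integral>S. empirical_risk m l S h \<partial>sample_space) = risk D l h"
    using m by (simp add: integral_point_loss_component(2)[OF assms])
qed

lemma signed_mean_uminus: "signed_mean (- \<sigma>) S h = - signed_mean \<sigma> S h"
  by (simp add: signed_mean_def sum_negf)

text \<open>Exchanging the points of the sample and the ghost sample where \<open>\<sigma> i = -1\<close> turns the
  difference of the two empirical risks into a signed one.\<close>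

lemma empirical_risk_diff_eq:
  assumes "\<sigma> \<in> sign_vectors m"
  shows "empirical_risk m l S h - empirical_risk m l S' h
    = signed_mean \<sigma> (swap_by_sign m \<sigma> S S') h + signed_mean (- \<sigma>) (swap_by_sign m \<sigma> S' S) h"
proof -
  have "(\<Sum>i<m. point_loss h (S i)) - (\<Sum>i<m. point_loss h (S' i))
    = (\<Sum>i<m. \<sigma> i * point_loss h (swap_by_sign m \<sigma> S S' i))
      - (\<Sum>i<m. \<sigma> i * point_loss h (swap_by_sign m \<sigma> S' S i))"
    unfolding sum_subtractf[symmetric]
    by (rule sum.cong) (use sign_vectorsD[OF assms] in \<open>fastforce simp: swap_by_sign_def\<close>)+
  then show ?thesis
    unfolding signed_mean_uminus
    by (simp add: empirical_risk_eq signed_mean_def flip: diff_divide_distrib)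
qed

lemma empirical_risk_diff_le:
  assumes \<sigma>: "\<sigma> \<in> sign_vectors m" and S: "S \<in> space sample_space" and S': "S' \<in> space sample_space"
    and h: "h \<in> H"
  shows "empirical_risk m l S h - empirical_risk m l S' h
    \<le> rademacher_sup m l H \<sigma> (swap_by_sign m \<sigma> S S')
      + rademacher_sup m l H (- \<sigma>) (swap_by_sign m \<sigma> S' S)"
  unfolding empirical_risk_diff_eq[OF \<sigma>]
  using \<sigma> S S' h
  by (intro add_mono signed_mean_le_rademacher_sup uminus_sign_vectors swap_by_sign_in_space)

text \<open>The two differences have opposite orientation, so the previous bound is applied with the
  samples in either order. This yields each sign vector \<open>\<sigma>\<close> and
  \<open>- \<sigma>\<close> on each half of the exchanged pair.\<close>

lemma empirical_risk_diffs_le_swapped_sup: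
  assumes \<sigma>: "\<sigma> \<in> sign_vectors m" and S: "S \<in> space sample_space" and S': "S' \<in> space sample_space"
    and h: "h \<in> H" "h0 \<in> H"
  shows "(empirical_risk m l S' h - empirical_risk m l S h)
      + (empirical_risk m l S h0 - empirical_risk m l S' h0)
    \<le> swapped_sup \<sigma> S S' + swapped_sup (- \<sigma>) S S'"
  using empirical_risk_diff_le[OF \<sigma> S' S h(1)] empirical_risk_diff_le[OF \<sigma> S S' h(2)]
  by (simp add: swapped_sup_def swap_by_sign_uminus[OF \<sigma>])

text \<open>A risk is the expected empirical risk on the ghost sample. With \<open>S\<close> and
  both hypotheses fixed, the bound is integrated over the ghost sample only, so \<open>h\<close> may
  depend on \<open>S\<close> in any way, measurable or not. The bound holds for every
  \<open>\<sigma>\<close>, hence for the average.\<close>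

lemma excess_risk_le_ghost_deviation:
  assumes S: "S \<in> space sample_space" and h: "h \<in> H" "h0 \<in> H"
    and le: "empirical_risk m l S h \<le> empirical_risk m l S h0"
  shows "risk D l h - risk D l h0 \<le> ghost_deviation S"
proof -
  let ?I = "\<lambda>\<sigma>. \<integral>S'. swapped_sup \<sigma> S S' \<partial>sample_space"
  have bound: "risk D l h - risk D l h0 \<le> ?I \<sigma> + ?I (- \<sigma>)" if \<sigma>: "\<sigma> \<in> sign_vectors m" for \<sigma>
  proof -
    note int = expectation_empirical_risk(1)[OF h(1)] expectation_empirical_risk(1)[OF h(2)]
      swapped_sup_section_integrable[OF \<sigma> S]
      swapped_sup_section_integrable[OF uminus_sign_vectors[OF \<sigma>] S]
    have "risk D l h - risk D l h0
        = (\<integral>S'. empirical_risk m l S' h - empirical_risk m l S' h0 \<partial>sample_space)"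
      using int by (simp add: expectation_empirical_risk h)
    also have "\<dots> \<le> (\<integral>S'. swapped_sup \<sigma> S S' + swapped_sup (- \<sigma>) S S' \<partial>sample_space)"
    proof (intro integral_mono Bochner_Integration.integrable_diff
        Bochner_Integration.integrable_add int)
      fix S' assume "S' \<in> space sample_space"
      \<comment> \<open>By \<open>le\<close>, the difference of the empirical risks on
        \<open>S\<close> has the sign that lets it be dropped.\<close>
      from empirical_risk_diffs_le_swapped_sup[OF \<sigma> S this h] le
      show "empirical_risk m l S' h - empirical_risk m l S' h0
          \<le> swapped_sup \<sigma> S S' + swapped_sup (- \<sigma>) S S'"
        by linarith
    qed
    also have "\<dots> = ?I \<sigma> + ?I (- \<sigma>)"
      using int by simp
    finally show ?thesis .
  qed
  have "risk D l h - risk D l h0 \<le> sign_average m (\<lambda>\<sigma>. ?I \<sigma> + ?I (- \<sigma>))"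
    using bound by (rule le_sign_average)
  \<comment> \<open>Negation permutes the sign vectors, so the two averages coincide and give the
    factor 2.\<close>
  also have "\<dots> = ghost_deviation S"
    by (simp add: ghost_deviation_def sign_average_def sum.distrib sum_sign_vectors_uminus[of ?I])
  finally show ?thesis .
qed

section \<open>Concentration of the majorant\<close>

lemma ghost_deviation_tail:
  assumes B: "0 < B" and \<delta>: "0 < \<delta>" "\<delta> < 1"
  shows "samples.prob {S \<in> space sample_space. ghost_deviation S
      \<ge> 4 * rademacher_complexity D m l H + 2 * B * sqrt (ln (2 / \<delta>) / (2 * real m))} \<le> \<delta> / 2"
proof -
  define \<epsilon> where "\<epsilon> = 2 * B * sqrt (ln (2 / \<delta>) / (2 * real m))"
  have ln: "0 \<le> ln (2 / \<delta>)"
    using \<delta> by simp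
  have "samples.prob {S \<in> space sample_space. ghost_deviation S
      \<ge> (\<integral>S. ghost_deviation S \<partial>sample_space) + \<epsilon>} \<le> exp (- 2 * \<epsilon>\<^sup>2 / (\<Sum>i<m. (2 * B / m)\<^sup>2))"
  proof (rule coords.McDiarmid_inequality_ge)
    show "0 \<le> \<epsilon>"
      unfolding \<epsilon>_def using B ln by simp
  qed (use measurable_ghost_deviation ghost_deviation_bounded ghost_deviation_bounded_difference in auto)
  \<comment> \<open>The \<open>m\<close> squared differences sum to 4 B^2 / m, so the exponent is
    exactly -ln(2 / \<delta>).\<close>
  also have "\<epsilon>\<^sup>2 = 2 * B\<^sup>2 * ln (2 / \<delta>) / m"
    unfolding \<epsilon>_def using ln by (simp add: power_mult_distrib)
  also have "- 2 * (2 * B\<^sup>2 * ln (2 / \<delta>) / m) / (\<Sum>i<m. (2 * B / m)\<^sup>2) = - ln (2 / \<delta>)"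
    using B m by (simp add: power2_eq_square field_simps)
  also have "exp (- ln (2 / \<delta>)) = \<delta> / 2"
    using \<delta> by (simp add: exp_minus)
  finally show ?thesis
    unfolding \<epsilon>_def expectation_ghost_deviation .
qed

text \<open>Membership in the sample space is recorded in the event because the empirical minimizer
  is specified only there.\<close>

lemma ghost_deviation_whp:
  assumes \<delta>: "0 < \<delta>"
  shows "holds_with_prob sample_space (1 - \<delta>) (\<lambda>S. S \<in> space sample_space \<and>
    ghost_deviation S \<le> 4 * rademacher_complexity D m l H
      + 2 * B * sqrt (ln (2 / \<delta>) / (2 * real m)))"
proof (cases "1 \<le> \<delta>")
  case True
  then show ?thesis
    \<comment> \<open>The empty event has probability at least 1 - \<delta> here, whatever the sign
      of the logarithm.\<close>
    unfolding holds_with_prob_def by (intro bexI[of _ "{}"]) auto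
next
  case False
  let ?t = "4 * rademacher_complexity D m l H + 2 * B * sqrt (ln (2 / \<delta>) / (2 * real m))"
  note [measurable] = measurable_ghost_deviation
  show ?thesis
  \<comment> \<open>For \<open>B = 0\<close> the exponent in McDiarmid's inequality would be a
    division by 0 and the bound trivial. Instead, the Rademacher suprema and the majorant all vanish
    on the sample space.\<close>
  proof (cases "B = 0")
    case True
    have "rademacher_complexity D m l H = 0"
    proof -
      have "rademacher_sup m l H \<sigma> S = 0"
        if "\<sigma> \<in> sign_vectors m" "S \<in> space sample_space" for \<sigma> S
        using rademacher_sup_bounded[OF that] True by simp
      then have "(\<integral>S. rademacher_sup m l H \<sigma> S \<partial>sample_space) = 0" if "\<sigma> \<in> sign_vectors m" for \<sigma>
        using that by (simp cong: Bochner_Integration.integral_cong)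
      then show ?thesis
        by (simp add: rademacher_complexity_eq)
    qed
    then have "ghost_deviation S \<le> ?t" if "S \<in> space sample_space" for S
      using ghost_deviation_bounded[OF that] True by simp
    then show ?thesis
      unfolding holds_with_prob_def using \<delta>
      by (intro bexI[of _ "space sample_space"]) (auto simp: samples.prob_space)
  next
    case B: False
    let ?A = "{S \<in> space sample_space. ghost_deviation S \<le> ?t}"
    have "1 - samples.prob ?A = samples.prob {S \<in> space sample_space. \<not> ghost_deviation S \<le> ?t}"
      by (subst samples.prob_neg) simp_all
    also have "\<dots> \<le> samples.prob {S \<in> space sample_space. ghost_deviation S \<ge> ?t}"
      by (rule samples.finite_measure_mono) auto
    also have "\<dots> \<le> \<delta> / 2"
      using B B_nonneg False \<delta> by (intro ghost_deviation_tail) auto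
    finally show ?thesis
      unfolding holds_with_prob_def using \<delta> by (intro bexI[of _ ?A]) auto
  qed
qed

end

section \<open>Disintegration of the risk\<close>

text \<open>Restricting \<open>D\<close> to label \<open>y\<close> and projecting to the inputs
  gives the marginal with density \<open>p x y\<close>: on each measurable \<open>A\<close> this is
  the defining property of the conditional probability. The claim integrates \<open>g\<close>
  against both descriptions of this measure.\<close>

lemma cond_label_prob_section_integral:
  fixes g :: "'x \<Rightarrow> real"
  assumes D: "prob_space D" "sets D = sets (labelled X n)"
    and p: "cond_label_prob X n D p" and y: "y \<in> {1..n}"
    and g: "g \<in> borel_measurable X"
  shows "(\<integral>z. (if snd z = y then g (fst z) else 0) \<partial>D) = (\<integral>x. p x y * g x \<partial>marginal X D)"
proof -
  interpret D: prob_space D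
    by fact
  have space_D: "space D = space X \<times> {1..n}"
    using sets_eq_imp_space_eq[OF D(2)] by (simp add: space_pair_measure)
  have fst_measurable [measurable]: "fst \<in> D \<rightarrow>\<^sub>M X"
    unfolding measurable_cong_sets[OF D(2) refl] by simp
  have snd_measurable [measurable]: "snd \<in> D \<rightarrow>\<^sub>M count_space {1..n}"
    unfolding measurable_cong_sets[OF D(2) refl] by simp
  interpret N: prob_space "marginal X D"
    by (rule D.prob_space_distr) (rule fst_measurable)
  have p_measurable [measurable]: "(\<lambda>x. p x y) \<in> borel_measurable X"
    and p_nonneg: "\<And>x. x \<in> space X \<Longrightarrow> 0 \<le> p x y"
    and p_sum: "\<And>x. x \<in> space X \<Longrightarrow> (\<Sum>y=1..n. p x y) = 1"
    and p_nonneg': "\<And>x y. x \<in> space X \<Longrightarrow> y \<in> {1..n} \<Longrightarrow> 0 \<le> p x y"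
    and p_int: "\<And>A. A \<in> sets X \<Longrightarrow> measure D (A \<times> {y}) = (LINT x:A|marginal X D. p x y)"
    using p y unfolding cond_label_prob_def by auto
  have p_le_1: "p x y \<le> 1" if "x \<in> space X" for x
    using member_le_sum[of y "{1..n}" "p x"] p_nonneg'[OF that] p_sum[OF that] y by simp
  let ?i = "\<lambda>z. indicator {z \<in> space D. snd z = y} z :: real"
  have pred [measurable]: "Measurable.pred D (\<lambda>z. snd z = y)"
    using measurable_compose[OF snd_measurable, of "\<lambda>k. k = y" "count_space UNIV"] by simp
  have p_integrable: "integrable (marginal X D) (\<lambda>x. p x y)"
    by (rule N.integrable_const_bound[where B = 1]) (use p_nonneg p_le_1 in auto)
  have measures: "distr (density D (\<lambda>z. ennreal (?i z))) X fst
      = density (marginal X D) (\<lambda>x. ennreal (p x y))"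
  proof (rule measure_eqI)
    fix A assume "A \<in> sets (distr (density D (\<lambda>z. ennreal (?i z))) X fst)"
    then have A [measurable]: "A \<in> sets X"
      by simp
    have "emeasure (distr (density D (\<lambda>z. ennreal (?i z))) X fst) A
        = (\<integral>\<^sup>+z. ennreal (?i z) * indicator (fst -` A \<inter> space D) z \<partial>D)"
      by (subst emeasure_distr; (subst emeasure_density)?) auto
    also have "\<dots> = (\<integral>\<^sup>+z. indicator (A \<times> {y}) z \<partial>D)"
      using y sets.sets_into_space[OF A]
      by (intro nn_integral_cong) (auto simp: space_D split: split_indicator)
    also have "\<dots> = emeasure D (A \<times> {y})"
      by (rule nn_integral_indicator) (use y D(2) in auto)
    also have "\<dots> = ennreal (LINT x:A|marginal X D. p x y)"
      by (simp add: D.emeasure_eq_measure p_int)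
    also have "\<dots> = (\<integral>\<^sup>+x. ennreal (indicator A x *\<^sub>R p x y) \<partial>marginal X D)"
      unfolding set_lebesgue_integral_def
      by (rule nn_integral_eq_integral[symmetric])
        (use p_nonneg integrable_mult_indicator[OF _ p_integrable, of A] in
          \<open>auto split: split_indicator\<close>)
    also have "\<dots> = emeasure (density (marginal X D) (\<lambda>x. ennreal (p x y))) A"
      by (subst emeasure_density) (auto intro!: nn_integral_cong split: split_indicator)
    finally show "emeasure (distr (density D (\<lambda>z. ennreal (?i z))) X fst) A
        = emeasure (density (marginal X D) (\<lambda>x. ennreal (p x y))) A" .
  qed simp
  have "(\<integral>z. (if snd z = y then g (fst z) else 0) \<partial>D) = (\<integral>z. ?i z *\<^sub>R g (fst z) \<partial>D)"
    by (intro Bochner_Integration.integral_cong) auto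
  also have "\<dots> = (\<integral>z. g (fst z) \<partial>density D (\<lambda>z. ennreal (?i z)))"
    using g by (intro integral_density[symmetric]) auto
  also have "\<dots> = (\<integral>x. g x \<partial>distr (density D (\<lambda>z. ennreal (?i z))) X fst)"
    using g by (intro integral_distr[symmetric]) auto
  also have "\<dots> = (\<integral>x. p x y *\<^sub>R g x \<partial>marginal X D)"
    unfolding measures using g p_nonneg by (intro integral_density) auto
  finally show ?thesis
    by simp
qed

text \<open>The integrand is split according to the label. On each piece it is a function of the
  input alone, and the previous lemma applies; boundedness makes the finitely many pieces
  integrable.\<close>

lemma integral_cond_label_prob:
  fixes f :: "'x \<Rightarrow> nat \<Rightarrow> real"
  assumes D: "prob_space D" "sets D = sets (labelled X n)"
    and p: "cond_label_prob X n D p"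
    and f: "(\<lambda>(x, y). f x y) \<in> borel_measurable (labelled X n)"
    and bounded: "\<And>x y. x \<in> space X \<Longrightarrow> y \<in> {1..n} \<Longrightarrow> \<bar>f x y\<bar> \<le> K"
  shows "(\<integral>(x, y). f x y \<partial>D) = (\<integral>x. (\<Sum>y=1..n. p x y * f x y) \<partial>marginal X D)"
    and "integrable (marginal X D) (\<lambda>x. \<Sum>y=1..n. p x y * f x y)"
proof -
  interpret D: prob_space D
    by fact
  have space_D: "space D = space X \<times> {1..n}"
    using sets_eq_imp_space_eq[OF D(2)] by (simp add: space_pair_measure)
  have fst_measurable [measurable]: "fst \<in> D \<rightarrow>\<^sub>M X"
    unfolding measurable_cong_sets[OF D(2) refl] by simp
  have snd_measurable [measurable]: "snd \<in> D \<rightarrow>\<^sub>M count_space {1..n}"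
    unfolding measurable_cong_sets[OF D(2) refl] by simp
  interpret N: prob_space "marginal X D"
    by (rule D.prob_space_distr) (rule fst_measurable)
  have f_section [measurable]: "(\<lambda>x. f x y) \<in> borel_measurable X" if "y \<in> {1..n}" for y
    using measurable_Pair1[OF f, of y] that by simp
  have p_measurable [measurable]: "\<And>y. y \<in> {1..n} \<Longrightarrow> (\<lambda>x. p x y) \<in> borel_measurable X"
    and p_sum: "\<And>x. x \<in> space X \<Longrightarrow> (\<Sum>y=1..n. p x y) = 1"
    and p_nonneg: "\<And>x y. x \<in> space X \<Longrightarrow> y \<in> {1..n} \<Longrightarrow> 0 \<le> p x y"
    using p unfolding cond_label_prob_def by auto
  have p_le_1: "p x y \<le> 1" if "x \<in> space X" "y \<in> {1..n}" for x y
    using member_le_sum[of y "{1..n}" "p x"] p_nonneg[OF that(1)] p_sum[OF that(1)] that(2) by simp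
  have int_D: "integrable D (\<lambda>z. if snd z = y then f (fst z) y else 0)" if y: "y \<in> {1..n}" for y
  \<comment> \<open>The absolute value of \<open>K\<close> also dominates the value 0 taken at the
    other labels.\<close>
  proof (rule D.integrable_const_bound[where B = "\<bar>K\<bar>"])
    have [measurable]: "Measurable.pred D (\<lambda>z. snd z = y)"
      using measurable_compose[OF snd_measurable, of "\<lambda>k. k = y" "count_space UNIV"] by simp
    show "(\<lambda>z. if snd z = y then f (fst z) y else 0) \<in> borel_measurable D"
      using measurable_compose[OF fst_measurable f_section[OF y]] by measurable
    have "\<bar>f x y\<bar> \<le> \<bar>K\<bar>" if "x \<in> space X" for x
      using bounded[OF that y] by linarith
    then show "AE z in D. norm (if snd z = y then f (fst z) y else 0) \<le> \<bar>K\<bar>"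
      by (intro AE_I2) (auto simp: space_D)
  qed
  have int_N: "integrable (marginal X D) (\<lambda>x. p x y * f x y)" if y: "y \<in> {1..n}" for y
  proof (rule N.integrable_const_bound[where B = "1 * K"])
    have "(\<lambda>x. p x y * f x y) \<in> borel_measurable X"
      using p_measurable[OF y] f_section[OF y] by (rule borel_measurable_times)
    then show "(\<lambda>x. p x y * f x y) \<in> borel_measurable (marginal X D)"
      by simp
    have "\<bar>p x y * f x y\<bar> \<le> 1 * K" if "x \<in> space X" for x
      unfolding abs_mult using p_nonneg[OF that y] p_le_1[OF that y] bounded[OF that y]
      by (intro mult_mono) auto
    then show "AE x in marginal X D. norm (p x y * f x y) \<le> 1 * K"
      by (intro AE_I2) simp
  qed
  have "(\<integral>(x, y). f x y \<partial>D) = (\<integral>z. (\<Sum>y=1..n. if snd z = y then f (fst z) y else 0) \<partial>D)"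
    by (intro Bochner_Integration.integral_cong) (auto simp: space_D)
  also have "\<dots> = (\<Sum>y=1..n. \<integral>z. (if snd z = y then f (fst z) y else 0) \<partial>D)"
    by (rule Bochner_Integration.integral_sum) (rule int_D)
  also have "\<dots> = (\<Sum>y=1..n. \<integral>x. p x y * f x y \<partial>marginal X D)"
    by (intro sum.cong refl cond_label_prob_section_integral[OF D p] f_section)
  also have "\<dots> = (\<integral>x. (\<Sum>y=1..n. p x y * f x y) \<partial>marginal X D)"
    by (rule Bochner_Integration.integral_sum[symmetric]) (rule int_N)
  finally show "(\<integral>(x, y). f x y \<partial>D) = (\<integral>x. (\<Sum>y=1..n. p x y * f x y) \<partial>marginal X D)" .
  show "integrable (marginal X D) (\<lambda>x. \<Sum>y=1..n. p x y * f x y)"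
    using int_N by (rule Bochner_Integration.integrable_sum)
qed

text \<open>The pointwise infimum is below the conditional risk of \<open>h\<close>, which
  integrates to its risk. In the final proof this makes the argument of \<open>\<Gamma>\<close>
  nonnegative.\<close>

lemma integral_best_cond_risk_le_risk:
  assumes D: "prob_space D" "sets D = sets (labelled X n)"
    and p: "cond_label_prob X n D p"
    and loss_measurable: "\<And>h. h \<in> H \<Longrightarrow> (\<lambda>(x, y). l h x y) \<in> borel_measurable (labelled X n)"
    and loss_bounded:
      "\<And>h x y. h \<in> H \<Longrightarrow> x \<in> space X \<Longrightarrow> y \<in> {1..n} \<Longrightarrow> 0 \<le> l h x y \<and> l h x y \<le> B"
    and measurable: "best_cond_risk n p l H \<in> borel_measurable X"
    and h: "h \<in> H"
  shows "(LINT x|marginal X D. best_cond_risk n p l H x) \<le> risk D l h"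
proof -
  have p_nonneg: "\<And>x y. x \<in> space X \<Longrightarrow> y \<in> {1..n} \<Longrightarrow> 0 \<le> p x y"
    using p unfolding cond_label_prob_def by auto
  have cond_risk_nonneg: "0 \<le> (\<Sum>y=1..n. p x y * l h' x y)" if "h' \<in> H" "x \<in> space X" for h' x
    using that p_nonneg loss_bounded by (intro sum_nonneg mult_nonneg_nonneg) auto
  have le: "best_cond_risk n p l H x \<le> (\<Sum>y=1..n. p x y * l h x y)" if x: "x \<in> space X" for x
    unfolding best_cond_risk_def
    by (intro cINF_lower h bdd_belowI2[of _ 0] cond_risk_nonneg x)
  have nonneg: "0 \<le> best_cond_risk n p l H x" if x: "x \<in> space X" for x
    unfolding best_cond_risk_def using h by (intro cINF_greatest cond_risk_nonneg x) auto
  have bounded: "\<And>x y. x \<in> space X \<Longrightarrow> y \<in> {1..n} \<Longrightarrow> \<bar>l h x y\<bar> \<le> B"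
    using loss_bounded[OF h] by auto
  have disintegration:
    "(\<integral>(x, y). l h x y \<partial>D) = (\<integral>x. (\<Sum>y=1..n. p x y * l h x y) \<partial>marginal X D)"
    "integrable (marginal X D) (\<lambda>x. \<Sum>y=1..n. p x y * l h x y)"
    by (rule integral_cond_label_prob[OF D p loss_measurable[OF h]], rule bounded, assumption+)+
  have "integrable (marginal X D) (best_cond_risk n p l H)"
    by (rule Bochner_Integration.integrable_bound[OF disintegration(2)])
      (use measurable le nonneg in \<open>auto intro!: order_trans[OF _ abs_ge_self]\<close>)
  then have "(LINT x|marginal X D. best_cond_risk n p l H x)
      \<le> (\<integral>x. (\<Sum>y=1..n. p x y * l h x y) \<partial>marginal X D)"
    by (rule integral_mono[OF _ disintegration(2)]) (use le in auto)
  then show ?thesis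
    unfolding risk_def disintegration(1) .
qed

section \<open>Excess risk of the empirical minimizer\<close>

theorem mainTheorem10:
  fixes X :: "'x measure" and n m :: nat and D :: "('x \<times> nat) measure"
    and p :: "'x \<Rightarrow> nat \<Rightarrow> real" and H :: "'x hyp set" and l :: "'x loss" and B :: real
    and \<Gamma> :: "real \<Rightarrow> real" and hhat :: "'x sample \<Rightarrow> 'x hyp" and \<delta> :: real
  assumes D: "prob_space D" "sets D = sets (labelled X n)"
    and p: "cond_label_prob X n D p"
    and H: "\<And>h. h \<in> H \<Longrightarrow> (\<lambda>(x, y). h x y) \<in> borel_measurable (labelled X n)"
    and loss_measurable: "\<And>h. h \<in> H \<Longrightarrow> (\<lambda>(x, y). l h x y) \<in> borel_measurable (labelled X n)"
    and loss_bounded: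
      "\<And>h x y. h \<in> H \<Longrightarrow> x \<in> space X \<Longrightarrow> y \<in> {1..n} \<Longrightarrow> 0 \<le> l h x y \<and> l h x y \<le> B"
    and best_cond_risk_measurable:
      "best_cond_risk n p l H \<in> borel_measurable X"
      "best_cond_risk n p (zero_one_loss n) H \<in> borel_measurable X"
    and rademacher_sup_measurable:
      "\<And>\<sigma>. (\<And>i. i < m \<Longrightarrow> \<sigma> i \<in> {-1, 1}) \<Longrightarrow>
         rademacher_sup m l H \<sigma> \<in> borel_measurable (iid_sample D m)"
    and Gamma: "\<And>t. 0 \<le> t \<Longrightarrow> 0 \<le> \<Gamma> t" "mono_on {0..} \<Gamma>" "concave_on {0..} \<Gamma>"
    and consistency_bound:
      "\<And>h. h \<in> H \<Longrightarrow>
         risk D (zero_one_loss n) h - best_risk D (zero_one_loss n) H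
           + minimizability_gap X n D p (zero_one_loss n) H
         \<le> \<Gamma> (risk D l h - best_risk D l H + minimizability_gap X n D p l H)"
    and m: "1 \<le> m"
    and hhat: "\<And>S. S \<in> space (iid_sample D m) \<Longrightarrow>
         is_arg_min (empirical_risk m l S) (\<lambda>h. h \<in> H) (hhat S)"
    and \<delta>: "0 < \<delta>"
  shows "holds_with_prob (iid_sample D m) (1 - \<delta>)
    (\<lambda>S. risk D (zero_one_loss n) (hhat S) - best_risk D (zero_one_loss n) H
      \<le> \<Gamma> (4 * rademacher_complexity D m l H + 2 * B * sqrt (ln (2 / \<delta>) / (2 * real m))
            + minimizability_gap X n D p l H)
        - minimizability_gap X n D p (zero_one_loss n) H)"
proof -
  interpret D: prob_space D
    by (rule D(1))
  interpret samples: prob_space "iid_sample D m"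
    by (rule prob_space_PiM) (rule D(1))
  have space_D: "space D = space X \<times> {1..n}"
    using sets_eq_imp_space_eq[OF D(2)] by (simp add: space_pair_measure)
  have cond_risk_le: "(LINT x|marginal X D. best_cond_risk n p l H x) \<le> risk D l h"
    if "h \<in> H" for h
    using loss_measurable loss_bounded
    by (intro integral_best_cond_risk_le_risk[OF D p _ _ best_cond_risk_measurable(1) that])
  have minimizer: "hhat S \<in> H"
    "\<And>h. h \<in> H \<Longrightarrow> empirical_risk m l S (hhat S) \<le> empirical_risk m l S h"
    if "S \<in> space (iid_sample D m)" for S
    using hhat[OF that] by (auto simp: is_arg_min_linorder)
  \<comment> \<open>The sample space carries a probability measure, so some sample exists, and its
    minimizer lies in \<open>H\<close>.\<close>
  have H_nonempty: "H \<noteq> {}"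
    using samples.not_empty minimizer(1) by blast
  have loss_measurable': "(\<lambda>(x, y). l h x y) \<in> borel_measurable D" if "h \<in> H" for h
    using loss_measurable[OF that] unfolding measurable_cong_sets[OF D(2) refl] .
  interpret bounded_loss_class D m H l B
    by unfold_locales
      (use m H_nonempty loss_measurable' loss_bounded rademacher_sup_measurable space_D in auto)
  let ?t = "4 * rademacher_complexity D m l H + 2 * B * sqrt (ln (2 / \<delta>) / (2 * real m))"
  have "risk D (zero_one_loss n) (hhat S) - best_risk D (zero_one_loss n) H
      \<le> \<Gamma> (?t + minimizability_gap X n D p l H) - minimizability_gap X n D p (zero_one_loss n) H"
    if S: "S \<in> space (iid_sample D m)" and dev: "ghost_deviation S \<le> ?t" for S
  proof -
    note hS = minimizer(1)[OF S]
    \<comment> \<open>The best risk need not be attained, so the comparison is made with every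
      \<open>h\<close> in \<open>H\<close> and passed to the infimum.\<close>
    have "risk D l (hhat S) - ghost_deviation S \<le> best_risk D l H"
      unfolding best_risk_def
    proof (rule cINF_greatest[OF H_nonempty])
      fix h assume "h \<in> H"
      then show "risk D l (hhat S) - ghost_deviation S \<le> risk D l h"
        using excess_risk_le_ghost_deviation[OF S hS, of h] minimizer(2)[OF S, of h] by simp
    qed
    with dev have excess: "risk D l (hhat S) - best_risk D l H \<le> ?t"
      by linarith
    \<comment> \<open>The best risk cancels against the one in the gap, leaving the risk minus the
      expected best conditional risk. Monotonicity of \<open>\<Gamma>\<close> is available only on
      nonnegative arguments.\<close>
    have "0 \<le> risk D l (hhat S) - best_risk D l H + minimizability_gap X n D p l H"
      using cond_risk_le[OF hS] by (simp add: minimizability_gap_def)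
    with excess have "\<Gamma> (risk D l (hhat S) - best_risk D l H + minimizability_gap X n D p l H)
        \<le> \<Gamma> (?t + minimizability_gap X n D p l H)"
      by (intro mono_onD[OF Gamma(2)]) auto
    with consistency_bound[OF hS] show ?thesis
      by linarith
  qed
  then show ?thesis
    \<comment> \<open>The measurable event is the one for the majorant; it does not involve the
      selection \<open>hhat\<close>.\<close>
    using ghost_deviation_whp[OF \<delta>] unfolding holds_with_prob_def by fast
qed

end
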